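(* Let $\theta>0$, $0\le\alpha<1$, $n\ge1$, and let $n^*_{\frac12}$ be the separation distance mixing time for the down-up walk with parameters $\theta,\alpha$ on the $n$th level of the Kingman lattice. Let $T$ be the sum of independent geometric random variables with parameters $\frac{i(\theta+i-1)}{n(\theta+n-1)}$ for $2\le i\le n$. Then $$\frac{\mathbb{E}[T]}{2}\le n^*_{\frac12}\le2\,\mathbb{E}[T].$$ Moreover, if $\theta=1$ then $$\mathbb{E}[T]=\sum_{i=2}^n\frac{n^2}{i^2}\sim n^2\left(\frac{\pi^2}{6}-1\right)\quad(n\to\infty),$$ and if $\theta\ne1$ then $$\frac{n(\theta+n-1)}{\theta-1}\log\left(\frac{(n+1)(\theta+1)}{2(n+\theta)}\right)\le\mathbb{E}[T]=\sum_{i=2}^n\frac{n(\theta+n-1)}{i(\theta+i-1)}\le\frac{n(\theta+n-1)}{\theta-1}\log\left(\frac{n\theta}{n+\theta-1}\right).$$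
   Context: For a partition $\lambda$, $m_k(\lambda)$ is the number of parts (rows) of size $k$ and $l(\lambda)$ the number of parts. Down chain: from a partition $\lambda$ of $n$, for each $j\ge1$ with $m_j(\lambda)>0$, remove a box from a row of length $j$ (replace a part $j$ by $j-1$) with probability $\frac{j\,m_j(\lambda)}{n}$, obtaining a partition of $n-1$. Up chain: from a partition $\lambda$ of $n$, for each $k\ge1$ add a box to a row of length $k$ (replace a part $k$ by $k+1$) with probability $\frac{(k-\alpha)m_k(\lambda)}{\theta+n}$, and add a new part of size $1$ with probability $\frac{\theta+\alpha l(\lambda)}{\theta+n}$, obtaining a partition of $n+1$. The down-up walk on the $n$th level of the Kingman lattice is the Markov chain $K$ on partitions of $n$ taking one down step (to a partition of $n-1$) and then one up step. Its stationary distribution is the Pitman distribution $$\pi(\lambda)=\frac{\theta(\theta+\alpha)\cdots(\theta+(l(\lambda)-1)\alpha)}{\theta(\theta+1)\cdots(\theta+n-1)}\,\frac{n!}{\prod_k m_k(\lambda)!\prod_{i=1}^{l(\lambda)}\lambda_i!}\prod_{(i,j)\in\lambda,\ j\ge2}(j-1-\alpha),$$ the last product being over boxes $(i,j)$ (row $i$, column $j$) of the diagram of $\lambda$. The maximal separation distance is $s^*(r)=\max_{x,y}\left[1-\frac{K^r(x,y)}{\pi(y)}\right]$, and the separation distance mixing time $n^*_{\frac12}$ is the smallest integer $r\ge0$ with $s^*(r)\le\frac12$. A geometric random variable $X$ with parameter $p\in(0,1]$ satisfies $\mathbb{P}(X=m)=p(1-p)^{m-1}$ for $m\ge1$. An empty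 sum is $0$. $f(n)\sim g(n)$ means $f(n)/g(n)\to1$. *)

theory Defs
  imports "HOL-Probability.Probability" "HOL-Library.Landau_Symbols"
begin

text \<open>A partition is represented by the multiset of its (positive) parts, so that
  \<open>count x k\<close> is the multiplicity \<open>m\<^sub>k(x)\<close> and \<open>size x\<close> is the number of parts \<open>l(x)\<close>.\<close>

definition partitions :: "nat \<Rightarrow> nat multiset set" where
  "partitions n = {x. 0 \<notin># x \<and> sum_mset x = n}"

definition remove_box :: "nat \<Rightarrow> nat multiset \<Rightarrow> nat multiset" where
  "remove_box j x = (if j = 1 then x - {#1#} else (x - {#j#}) + {#j - 1#})"

definition add_box :: "nat \<Rightarrow> nat multiset \<Rightarrow> nat multiset" where
  "add_box k x = (x - {#k#}) + {#k + 1#}"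

text \<open>Transition probabilities of the two chains.  The sums range over the distinct part
  sizes of \<open>x\<close>, that is, over the \<open>j \<ge> 1\<close> with \<open>m\<^sub>j(x) > 0\<close>, and \<open>sum_mset x\<close> is the
  number that \<open>x\<close> partitions.\<close>

definition down_prob :: "nat multiset \<Rightarrow> nat multiset \<Rightarrow> real" where
  "down_prob x y =
     (\<Sum>j\<in>set_mset x. if y = remove_box j x
        then real j * real (count x j) / real (sum_mset x) else 0)"

definition up_prob :: "real \<Rightarrow> real \<Rightarrow> nat multiset \<Rightarrow> nat multiset \<Rightarrow> real" where
  "up_prob \<theta> \<alpha> x y =
     (\<Sum>k\<in>set_mset x. if y = add_box k x
        then (real k - \<alpha>) * real (count x k) / (\<theta> + real (sum_mset x)) else 0)
     + (if y = x + {#1#}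
        then (\<theta> + \<alpha> * real (size x)) / (\<theta> + real (sum_mset x)) else 0)"

definition down_up :: "real \<Rightarrow> real \<Rightarrow> nat \<Rightarrow> nat multiset \<Rightarrow> nat multiset \<Rightarrow> real" where
  "down_up \<theta> \<alpha> n x y = (\<Sum>z\<in>partitions (n - 1). down_prob x z * up_prob \<theta> \<alpha> z y)"

primrec down_up_pow :: "real \<Rightarrow> real \<Rightarrow> nat \<Rightarrow> nat \<Rightarrow> nat multiset \<Rightarrow> nat multiset \<Rightarrow> real" where
  "down_up_pow \<theta> \<alpha> n 0 x y = (if x = y then 1 else 0)"
| "down_up_pow \<theta> \<alpha> n (Suc r) x y =
     (\<Sum>z\<in>partitions n. down_up_pow \<theta> \<alpha> n r x z * down_up \<theta> \<alpha> n z y)"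

text \<open>The last factor is the product over the boxes \<open>(i, j)\<close> with \<open>j \<ge> 2\<close>, taken row by row;
  \<open>pochhammer \<theta> n = \<theta> (\<theta> + 1) \<cdots> (\<theta> + n - 1)\<close>.\<close>

definition pitman :: "real \<Rightarrow> real \<Rightarrow> nat \<Rightarrow> nat multiset \<Rightarrow> real" where
  "pitman \<theta> \<alpha> n x =
     (\<Prod>i<size x. \<theta> + real i * \<alpha>) / pochhammer \<theta> n
     * (fact n / ((\<Prod>k\<in>set_mset x. fact (count x k)) * (\<Prod>p\<in>#x. fact p)))
     * (\<Prod>p\<in>#x. \<Prod>j\<in>{2..p}. real j - 1 - \<alpha>)"

definition max_separation :: "real \<Rightarrow> real \<Rightarrow> nat \<Rightarrow> nat \<Rightarrow> real" where
  "max_separation \<theta> \<alpha> n r =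
     Max {1 - down_up_pow \<theta> \<alpha> n r x y / pitman \<theta> \<alpha> n y | x y.
            x \<in> partitions n \<and> y \<in> partitions n}"

definition sep_mixing_time :: "real \<Rightarrow> real \<Rightarrow> nat \<Rightarrow> nat" where
  "sep_mixing_time \<theta> \<alpha> n = (LEAST r. max_separation \<theta> \<alpha> n r \<le> 1 / 2)"

definition geometric_rv :: "'a measure \<Rightarrow> real \<Rightarrow> ('a \<Rightarrow> nat) \<Rightarrow> bool" where
  "geometric_rv M p X \<longleftrightarrow>
     X \<in> measurable M (count_space UNIV) \<and>
     (\<forall>m\<ge>1. measure M {\<omega> \<in> space M. X \<omega> = m} = p * (1 - p) ^ (m - 1))"

definition indep_geometrics :: "real \<Rightarrow> nat \<Rightarrow> 'a measure \<Rightarrow> (nat \<Rightarrow> 'a \<Rightarrow> nat) \<Rightarrow> bool" where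
  "indep_geometrics \<theta> n M X \<longleftrightarrow>
     prob_space M \<and>
     prob_space.indep_vars M (\<lambda>_. count_space UNIV) X {2..n} \<and>
     (\<forall>i\<in>{2..n}. geometric_rv M
        (real i * (\<theta> + real i - 1) / (real n * (\<theta> + real n - 1))) (X i))"

definition expectation_of_sum :: "nat \<Rightarrow> 'a measure \<Rightarrow> (nat \<Rightarrow> 'a \<Rightarrow> nat) \<Rightarrow> real" where
  "expectation_of_sum n M X = integral\<^sup>L M (\<lambda>\<omega>. real (\<Sum>i\<in>{2..n}. X i \<omega>))"

end

(* Up and down steps, without their normalising constants, are operators on functions of
   partitions whose commutator at level n is the scalar 2 n + \<theta>.  Moving one down step past a
   block of up steps therefore turns the r-th power of the down-up walk into a mixture, over the
   position l of a pure death chain started at n, of the kernels "go down to level l, then come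
   back up".  For l <= 1 this kernel is the stationary distribution, because there is only one
   partition of 1; for l >= 2 it gives the pair x = (n), y = (1^n) mass 0.  Hence s*(r) is exactly
   the probability that the death chain is still above 1 at time r.  Its absorption time has
   expectation E = E[T], and E minus the sum of s*(r) over r < R is the expected remaining time
   at time R, which lies between 0 and E s*(R).  With R the mixing time both bounds follow. *)

theory Submission
  imports Defs
begin

section \<open>Commutation of up and down steps\<close>

text \<open>The sum over the multiset counts equal parts repeatedly, which supplies the
  multiplicities \<open>m_k\<close>. The factor \<open>1 / (\<theta> + n)\<close> of the up chain is
  left out; with it the commutator below would not be scalar on a level.\<close>

definition up_op :: "real \<Rightarrow> real \<Rightarrow> (nat multiset \<Rightarrow> real) \<Rightarrow> nat multiset \<Rightarrow> real" where
  "up_op \<theta> \<alpha> f x = (\<Sum>k\<in>#x. (real k - \<alpha>) * f (add_box k x))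
     + (\<theta> + \<alpha> * real (size x)) * f (x + {#1#})"

definition down_op :: "(nat multiset \<Rightarrow> real) \<Rightarrow> nat multiset \<Rightarrow> real" where
  "down_op f x = (\<Sum>j\<in>#x. real j * f (remove_box j x))"

text \<open>The product of the two normalising constants between levels \<open>l - 1\<close> and
  \<open>l\<close>: \<open>l\<close> for the step down and \<open>\<theta> + l - 1\<close> for the
  step up. Its increment from \<open>l\<close> to \<open>l + 1\<close> is
  \<open>2 * l + \<theta>\<close>, the commutator at level \<open>l\<close>.\<close>

definition rate :: "real \<Rightarrow> nat \<Rightarrow> real" where
  "rate \<theta> l = real l * (\<theta> + real l - 1)"

lemma rate_0 [simp]: "rate \<theta> 0 = 0"
  by (simp add: rate_def)

lemma rate_pos: "\<theta> > 0 \<Longrightarrow> l \<ge> 1 \<Longrightarrow> rate \<theta> l > 0"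
  by (simp add: rate_def)

lemma rate_mono:
  assumes "\<theta> > 0" "l \<le> n"
  shows "rate \<theta> l \<le> rate \<theta> n"
proof (cases "l = 0")
  case True
  then show ?thesis using assms rate_pos[of \<theta> n] by (cases "n = 0") auto
next
  case False
  then show ?thesis using assms unfolding rate_def by (intro mult_mono) auto
qed

lemma sum_mset_conv_count:
  fixes f :: "'a \<Rightarrow> real"
  shows "(\<Sum>k\<in>#x. f k) = (\<Sum>k\<in>set_mset x. real (count x k) * f k)"
proof (induction x)
  case (add a x)
  have "(\<Sum>k\<in>set_mset (add_mset a x). real (count (add_mset a x) k) * f k)
      = (\<Sum>k\<in>insert a (set_mset x). real (count x k) * f k + (if k = a then f a else 0))"
    by (intro sum.cong) (auto simp: algebra_simps)
  also have "\<dots> = (\<Sum>k\<in>insert a (set_mset x). real (count x k) * f k) + f a"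
    by (simp add: sum.distrib sum.delta)
  also have "(\<Sum>k\<in>insert a (set_mset x). real (count x k) * f k)
      = (\<Sum>k\<in>set_mset x. real (count x k) * f k)"
    by (rule sum.mono_neutral_right) (auto simp: count_eq_zero_iff)
  finally show ?case using add.IH by simp
qed simp

lemma sum_mset_remove1:
  fixes f :: "'a \<Rightarrow> 'b::ab_group_add"
  assumes "k \<in># x"
  shows "(\<Sum>j\<in>#x - {#k#}. f j) = (\<Sum>j\<in>#x. f j) - f k"
  using assms by (simp add: image_mset_Diff sum_mset_diff)

text \<open>Each side is the full double sum over pairs of occurrences minus its diagonal, and the
  full sum may be interchanged.\<close>

lemma sum_mset_offdiag_swap:
  fixes g :: "'a \<Rightarrow> 'a \<Rightarrow> real"
  shows "(\<Sum>k\<in>#x. \<Sum>j\<in>#x - {#k#}. g k j) = (\<Sum>j\<in>#x. \<Sum>k\<in>#x - {#j#}. g k j)"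
proof -
  have "(\<Sum>k\<in>#x. \<Sum>j\<in>#x - {#k#}. g k j) = (\<Sum>k\<in>#x. (\<Sum>j\<in>#x. g k j) - g k k)"
    by (intro arg_cong[where f = sum_mset] image_mset_cong sum_mset_remove1)
  moreover have "(\<Sum>j\<in>#x. \<Sum>k\<in>#x - {#j#}. g k j) = (\<Sum>j\<in>#x. (\<Sum>k\<in>#x. g k j) - g j j)"
    by (intro arg_cong[where f = sum_mset] image_mset_cong sum_mset_remove1)
  ultimately show ?thesis
    by (simp add: sum_mset_conv_count right_diff_distrib sum_subtractf sum_distrib_left)
       (subst sum.swap, simp add: algebra_simps)
qed

lemma remove_box_alt:
  "remove_box j x = x - {#j#} + (if j = 1 then {#} else {#j - 1#})"
  by (simp add: remove_box_def)

text \<open>Moves on two different rows commute, so only moves that return to \<open>x\<close>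
  differ. A row \<open>k >= 2\<close> gives \<open>(k - \<alpha>) * (k + 1)\<close> for up-down and
  \<open>k * (k - 1 - \<alpha>)\<close> for down-up, a difference of
  \<open>2 * k - \<alpha>\<close>. A row of length 1 gives the same: removing it leaves no row to
  extend, but lowers the weight of a new part by \<open>\<alpha>\<close>. A new part that is removed
  at once adds \<open>\<theta> + \<alpha> * size x\<close>, which cancels all the
  \<open>- \<alpha>\<close>.\<close>

lemma up_down_commute:
  assumes "0 \<notin># x"
  shows "up_op \<theta> \<alpha> (down_op f) x
       = down_op (up_op \<theta> \<alpha> f) x + (2 * real (sum_mset x) + \<theta>) * f x"
proof -
  \<comment> \<open>\<open>r j\<close> is what remains of a row \<open>j\<close> after losing a box,
    empty for \<open>j = 1\<close> because 0 is not a part. \<open>G k j\<close> belongs to moves on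
    two different rows, \<open>L j\<close> to a box lost by row \<open>j\<close> and a new
    part.\<close>
  define r :: "nat \<Rightarrow> nat multiset" where "r j = (if j = 1 then {#} else {#j - 1#})" for j
  define G where "G k j = f (x - {#k#} - {#j#} + {#k + 1#} + r j)" for k j
  define L where "L j = f (x - {#j#} + r j + {#1#})" for j
  have up1: "(\<Sum>k\<in>#x. (real k - \<alpha>) * down_op f (add_box k x))
      = (\<Sum>k\<in>#x. (\<Sum>j\<in>#x - {#k#}. (real k - \<alpha>) * real j * G k j) + (real k - \<alpha>) * (real k + 1) * f x)"
  proof (intro arg_cong[where f = sum_mset] image_mset_cong)
    fix k assume k: "k \<in># x"
    then have k0: "k \<noteq> 0" using assms by metis
    have "down_op f (add_box k x) = (\<Sum>j\<in>#x - {#k#}. real j * f (remove_box j (add_box k x)))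
        + (real k + 1) * f x"
      using k k0 by (simp add: down_op_def add_box_def remove_box_def)
    also have "(\<Sum>j\<in>#x - {#k#}. real j * f (remove_box j (add_box k x)))
        = (\<Sum>j\<in>#x - {#k#}. real j * G k j)"
    proof (intro arg_cong[where f = sum_mset] image_mset_cong)
      fix j assume "j \<in># x - {#k#}"
      then obtain v where v: "x = add_mset k (add_mset j v)"
        using k by (metis insert_DiffM)
      have "add_box k x = add_mset j (v + {#k + 1#})"
        by (simp add: v add_box_def add_mset_commute)
      then have "remove_box j (add_box k x) = v + {#k + 1#} + r j"
        by (simp add: remove_box_alt r_def)
      moreover have "G k j = f (v + {#k + 1#} + r j)"
        by (simp add: v G_def)
      ultimately show "real j * f (remove_box j (add_box k x)) = real j * G k j"
        by simp
    qed
    finally show "(real k - \<alpha>) * down_op f (add_box k x)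
        = (\<Sum>j\<in>#x - {#k#}. (real k - \<alpha>) * real j * G k j) + (real k - \<alpha>) * (real k + 1) * f x"
      by (simp add: algebra_simps sum_mset_distrib_left)
  qed
  have up2: "down_op f (x + {#1#}) = (\<Sum>j\<in>#x. real j * L j) + f x"
  proof -
    have "(\<Sum>j\<in>#x. real j * f (remove_box j (x + {#1#}))) = (\<Sum>j\<in>#x. real j * L j)"
      by (intro arg_cong[where f = sum_mset] image_mset_cong)
         (auto simp: add_mset_commute L_def r_def remove_box_def dest!: multi_member_split)
    then show ?thesis by (simp add: down_op_def remove_box_def)
  qed
  have down: "down_op (up_op \<theta> \<alpha> f) x
      = (\<Sum>j\<in>#x. (\<Sum>k\<in>#x - {#j#}. (real k - \<alpha>) * real j * G k j)
          + ((if j = 1 then 0 else real j * (real j - 1 - \<alpha>)) * f x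
             + real j * (\<theta> + \<alpha> * real (size x)) * L j - (if j = 1 then \<alpha> * f x else 0)))"
    unfolding down_op_def
  proof (intro arg_cong[where f = sum_mset] image_mset_cong)
    fix j assume j: "j \<in># x"
    then have j0: "j \<noteq> 0" using assms by metis
    obtain w where w: "x = add_mset j w" using j by (auto dest: multi_member_split)
    have a: "(\<Sum>k\<in>#w. (real k - \<alpha>) * f (add_box k (w + r j))) = (\<Sum>k\<in>#w. (real k - \<alpha>) * G k j)"
    proof (intro arg_cong[where f = sum_mset] image_mset_cong)
      fix k assume "k \<in># w"
      then obtain v where "w = add_mset k v" by (auto dest: multi_member_split)
      then show "(real k - \<alpha>) * f (add_box k (w + r j)) = (real k - \<alpha>) * G k j"
        by (simp add: w G_def add_box_def add_mset_commute)
    qed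
    have rem: "remove_box j x = w + r j"
      by (simp add: remove_box_alt w r_def)
    have b: "up_op \<theta> \<alpha> f (w + r j) = (\<Sum>k\<in>#w. (real k - \<alpha>) * G k j)
        + (if j = 1 then 0 else (real j - 1 - \<alpha>) * f x)
        + (\<theta> + \<alpha> * real (size (w + r j))) * L j"
      using j0 unfolding up_op_def
      by (simp add: a[symmetric]) (auto simp: r_def add_box_def w L_def of_nat_diff)
    have c: "real (size (w + r j)) = real (size x) - (if j = 1 then 1 else 0)"
      by (simp add: w r_def)
    have d: "j = 1 \<Longrightarrow> L j = f x" by (simp add: L_def r_def w)
    show "real j * up_op \<theta> \<alpha> f (remove_box j x) = (\<Sum>k\<in>#x - {#j#}. (real k - \<alpha>) * real j * G k j)
          + ((if j = 1 then 0 else real j * (real j - 1 - \<alpha>)) * f x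
             + real j * (\<theta> + \<alpha> * real (size x)) * L j - (if j = 1 then \<alpha> * f x else 0))"
      unfolding rem b c using d
      by (auto simp: w algebra_simps sum_mset_distrib_left)
  qed
  \<comment> \<open>The row-by-row comparison of the returning moves, by induction on the
    rows.\<close>
  have diag: "(\<Sum>k\<in>#w. (real k - \<alpha>) * (real k + 1) * c) + \<alpha> * real (size w) * c
      = (\<Sum>j\<in>#w. (if j = 1 then 0 else real j * (real j - 1 - \<alpha>)) * c - (if j = 1 then \<alpha> * c else 0))
        + 2 * real (sum_mset w) * c" if "0 \<notin># w" for w c
    using that
    by (induction w) (auto simp: algebra_simps)
  have "up_op \<theta> \<alpha> (down_op f) x = (\<Sum>k\<in>#x. \<Sum>j\<in>#x - {#k#}. (real k - \<alpha>) * real j * G k j)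
      + (\<Sum>k\<in>#x. (real k - \<alpha>) * (real k + 1) * f x)
      + (\<theta> + \<alpha> * real (size x)) * ((\<Sum>j\<in>#x. real j * L j) + f x)"
    unfolding up_op_def up1 up2 by (simp add: sum_mset.distrib)
  moreover have "down_op (up_op \<theta> \<alpha> f) x = (\<Sum>j\<in>#x. \<Sum>k\<in>#x - {#j#}. (real k - \<alpha>) * real j * G k j)
      + (\<Sum>j\<in>#x. (if j = 1 then 0 else real j * (real j - 1 - \<alpha>)) * f x - (if j = 1 then \<alpha> * f x else 0))
      + (\<theta> + \<alpha> * real (size x)) * (\<Sum>j\<in>#x. real j * L j)"
    unfolding down sum_mset.distrib[symmetric] sum_mset_distrib_left
    by (simp add: sum_mset.distrib[symmetric] algebra_simps)
  ultimately show ?thesis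
    using diag[OF assms, of "f x"] sum_mset_offdiag_swap[of "\<lambda>k j. (real k - \<alpha>) * real j * G k j" x]
    by (simp add: algebra_simps)
qed

section \<open>Partitions under adding and removing boxes\<close>

lemma partitionsD: "x \<in> partitions n \<Longrightarrow> 0 \<notin># x" "x \<in> partitions n \<Longrightarrow> sum_mset x = n"
  by (auto simp: partitions_def)

text \<open>Creating a part is thus the case \<open>k = 0\<close> of adding a box: subtracting the
  absent part 0 changes nothing.\<close>

lemma add_box_0: "0 \<notin># x \<Longrightarrow> add_box 0 x = x + {#1#}"
  by (simp add: add_box_def diff_single_trivial)

lemma add_box_in_partitions:
  assumes "x \<in> partitions n" "k \<in># x"
  shows "add_box k x \<in> partitions (Suc n)"
  using assms by (auto simp: partitions_def add_box_def dest!: multi_member_split)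

lemma add_part_in_partitions:
  assumes "x \<in> partitions n"
  shows "x + {#1#} \<in> partitions (Suc n)"
  using assms by (auto simp: partitions_def)

lemma remove_box_in_partitions:
  assumes "x \<in> partitions (Suc n)" "j \<in># x"
  shows "remove_box j x \<in> partitions n"
proof -
  have "j \<noteq> 0" using assms partitionsD(1) by metis
  with assms show ?thesis
    by (auto simp: partitions_def remove_box_def dest!: multi_member_split)
qed

text \<open>With \<open>remove_box_add_box\<close> this makes \<open>(x, k)\<close> and
  \<open>(y, k + 1)\<close> two names of one edge between neighbouring levels, seen from below and
  from above.\<close>

lemma add_box_remove_box:
  assumes "0 \<notin># y" "j \<in># y"
  shows "add_box (j - 1) (remove_box j y) = y"
proof -
  obtain w where w: "y = add_mset j w" using assms(2) by (auto dest: multi_member_split)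
  with assms show ?thesis
    by (auto simp: add_box_def remove_box_def diff_single_trivial)
qed

lemma remove_box_add_box:
  assumes "0 \<notin># x" "k \<in> insert 0 (set_mset x)"
  shows "remove_box (k + 1) (add_box k x) = x"
  using assms by (cases "k = 0") (auto simp: add_box_0 add_box_def remove_box_def)

lemma partitions_0: "partitions 0 = {{#}}"
proof -
  have "x = {#}" if "0 \<notin># x" "sum_mset x = (0::nat)" for x
    using that by (cases x) auto
  then show ?thesis by (auto simp: partitions_def)
qed

lemma finite_partitions: "finite (partitions n)"
proof (induction n)
  case 0
  then show ?case by (simp add: partitions_0)
next
  case (Suc n)
  have "partitions (Suc n) \<subseteq> (\<lambda>(x, k). add_box k x) ` (partitions n \<times> {..n})"
  proof
    fix y assume y: "y \<in> partitions (Suc n)"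
    then have "y \<noteq> {#}" by (auto simp: partitions_def)
    then obtain j where j: "j \<in># y" by auto
    then have "j \<le> Suc n" using y by (auto simp: partitions_def dest!: multi_member_split)
    then have "j - 1 \<in> {..n}" by auto
    with add_box_remove_box[OF partitionsD(1)[OF y] j] remove_box_in_partitions[OF y j]
    show "y \<in> (\<lambda>(x, k). add_box k x) ` (partitions n \<times> {..n})"
      by (intro image_eqI[of _ _ "(remove_box j y, j - 1)"]) auto
  qed
  then show ?case using Suc by (meson finite_subset finite_imageI finite_SigmaI finite_atMost)
qed

text \<open>The operators act on functions of all multisets, while the identities for them hold on
  one level of partitions only; the congruence rules bridge this gap.\<close>

lemma up_op_cong:
  assumes "\<And>y. y \<in> partitions (Suc n) \<Longrightarrow> f y = g y" "x \<in> partitions n"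
  shows "up_op \<theta> \<alpha> f x = up_op \<theta> \<alpha> g x"
  unfolding up_op_def
  by (intro arg_cong2[where f = "(+)"] arg_cong2[where f = "(*)"] refl
        arg_cong[where f = sum_mset] image_mset_cong assms(1))
     (use assms(2) add_box_in_partitions add_part_in_partitions in auto)

lemma down_op_cong:
  assumes "\<And>y. y \<in> partitions n \<Longrightarrow> f y = g y" "x \<in> partitions (Suc n)"
  shows "down_op f x = down_op g x"
  unfolding down_op_def
  by (intro arg_cong2[where f = "(*)"] refl arg_cong[where f = sum_mset] image_mset_cong assms(1))
     (use assms(2) remove_box_in_partitions in auto)

lemma down_pow_cong:
  assumes "\<And>y. y \<in> partitions l \<Longrightarrow> f y = g y" "x \<in> partitions (l + m)"
  shows "(down_op ^^ m) f x = (down_op ^^ m) g x"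
  using assms(2)
proof (induction m arbitrary: x)
  case (Suc m)
  then show ?case by (auto intro: down_op_cong[of "l + m"])
qed (use assms(1) in auto)

lemma up_op_linear:
  "up_op \<theta> \<alpha> (\<lambda>z. a * f z + b * g z) x = a * up_op \<theta> \<alpha> f x + b * up_op \<theta> \<alpha> g x"
proof -
  have "(\<Sum>k\<in>#x. (real k - \<alpha>) * (a * f (add_box k x) + b * g (add_box k x)))
      = a * (\<Sum>k\<in>#x. (real k - \<alpha>) * f (add_box k x)) + b * (\<Sum>k\<in>#x. (real k - \<alpha>) * g (add_box k x))"
    unfolding sum_mset_distrib_left sum_mset.distrib[symmetric]
    by (simp add: algebra_simps)
  then show ?thesis by (simp add: up_op_def algebra_simps)
qed

lemma down_op_linear:
  "down_op (\<lambda>z. a * f z + b * g z) x = a * down_op f x + b * down_op g x"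
  by (simp add: down_op_def algebra_simps sum_mset.distrib sum_mset_distrib_left)

lemma down_pow_linear:
  "(down_op ^^ m) (\<lambda>z. a * f z + b * g z) x = a * (down_op ^^ m) f x + b * (down_op ^^ m) g x"
proof (induction m arbitrary: x)
  case (Suc m)
  have "(down_op ^^ m) (\<lambda>z. a * f z + b * g z) = (\<lambda>x. a * (down_op ^^ m) f x + b * (down_op ^^ m) g x)"
    using Suc by blast
  then show ?case by (simp add: down_op_linear)
qed simp

lemma up_pow_linear:
  "(up_op \<theta> \<alpha> ^^ m) (\<lambda>z. a * f z + b * g z) x
     = a * (up_op \<theta> \<alpha> ^^ m) f x + b * (up_op \<theta> \<alpha> ^^ m) g x"
proof (induction m arbitrary: x)
  case (Suc m)
  have "(up_op \<theta> \<alpha> ^^ m) (\<lambda>z. a * f z + b * g z)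
      = (\<lambda>x. a * (up_op \<theta> \<alpha> ^^ m) f x + b * (up_op \<theta> \<alpha> ^^ m) g x)"
    using Suc by blast
  then show ?case by (simp add: up_op_linear)
qed simp

text \<open>Passing the up step at level \<open>k\<close> costs \<open>2 * k + \<theta>\<close>, for
  \<open>k\<close> from \<open>l\<close> to \<open>l + m - 1\<close>. These costs are the increments
  of \<open>rate \<theta>\<close> and telescope.\<close>

lemma up_pow_down_commute:
  assumes "x \<in> partitions l"
  shows "(up_op \<theta> \<alpha> ^^ m) (down_op f) x = down_op ((up_op \<theta> \<alpha> ^^ m) f) x
      + (rate \<theta> (l + m) - rate \<theta> l) * (up_op \<theta> \<alpha> ^^ (m - 1)) f x"
  using assms
proof (induction m arbitrary: x l)
  case (Suc m)
  let ?U = "up_op \<theta> \<alpha>"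
  have "(?U ^^ Suc m) (down_op f) x = ?U ((?U ^^ m) (down_op f)) x" by simp
  also have "\<dots> = ?U (\<lambda>z. 1 * down_op ((?U ^^ m) f) z
      + (rate \<theta> (Suc l + m) - rate \<theta> (Suc l)) * (?U ^^ (m - 1)) f z) x"
    by (rule up_op_cong[OF _ Suc.prems]) (simp add: Suc.IH)
  also have "\<dots> = ?U (down_op ((?U ^^ m) f)) x
      + (rate \<theta> (Suc l + m) - rate \<theta> (Suc l)) * ?U ((?U ^^ (m - 1)) f) x"
    by (subst up_op_linear) simp
  \<comment> \<open>For \<open>m = 0\<close> the exponent \<open>m - 1\<close> is truncated, but
    then the coefficient vanishes.\<close>
  also have "(rate \<theta> (Suc l + m) - rate \<theta> (Suc l)) * ?U ((?U ^^ (m - 1)) f) x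
      = (rate \<theta> (Suc l + m) - rate \<theta> (Suc l)) * (?U ^^ m) f x"
    by (cases m) auto
  also have "?U (down_op ((?U ^^ m) f)) x = down_op (?U ((?U ^^ m) f)) x
      + (2 * real l + \<theta>) * (?U ^^ m) f x"
    using up_down_commute[OF partitionsD(1)[OF Suc.prems]] partitionsD(2)[OF Suc.prems] by simp
  finally show ?case by (simp add: rate_def algebra_simps)
qed simp

text \<open>The kernel that goes from level \<open>n\<close> down to level \<open>l\<close> and back
  up, applied to \<open>f\<close>. The product of rates collects the constants of all
  \<open>2 * (n - l)\<close> steps.\<close>

definition level_op :: "real \<Rightarrow> real \<Rightarrow> nat \<Rightarrow> (nat multiset \<Rightarrow> real) \<Rightarrow> nat multiset \<Rightarrow> nat \<Rightarrow> real" where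
  "level_op \<theta> \<alpha> n f x l =
     (down_op ^^ (n - l)) ((up_op \<theta> \<alpha> ^^ (n - l)) f) x / (\<Prod>k\<in>{l<..n}. rate \<theta> k)"

text \<open>With \<open>m = n - l\<close>, the unnormalised composition is
  \<open>D^m U^m D U\<close>. Moving the inner \<open>D\<close> to the left past \<open>U^m\<close>
  yields \<open>D^(m+1) U^(m+1)\<close>, the kernel of level \<open>l - 1\<close>, plus
  \<open>rate \<theta> n - rate \<theta> l\<close> times \<open>D^m U^m\<close>. After division by
  \<open>rate \<theta> n\<close> the two coefficients are the jump and holding probabilities of the
  death chain.\<close>

lemma level_op_step:
  assumes "\<theta> > 0" "n \<ge> 1" "l \<le> n" "x \<in> partitions n"
  shows "level_op \<theta> \<alpha> n (\<lambda>z. down_op (up_op \<theta> \<alpha> f) z / rate \<theta> n) x l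
       = rate \<theta> l / rate \<theta> n * level_op \<theta> \<alpha> n f x (l - 1)
         + (1 - rate \<theta> l / rate \<theta> n) * level_op \<theta> \<alpha> n f x l"
proof -
  let ?U = "up_op \<theta> \<alpha>"
  let ?P = "\<lambda>l. \<Prod>k\<in>{l<..n}. rate \<theta> k"
  define m where "m = n - l"
  have x: "x \<in> partitions (l + m)" using assms by (simp add: m_def)
  have n: "n = l + m" using assms by (simp add: m_def)
  have rn: "rate \<theta> n > 0" using assms by (simp add: rate_pos)
  have "(?U ^^ m) (\<lambda>z. down_op (?U f) z / rate \<theta> n) = (\<lambda>z. (?U ^^ m) (down_op (?U f)) z / rate \<theta> n)"
    using up_pow_linear[where b = 0 and a = "1 / rate \<theta> n" and f = "down_op (?U f)"] by auto
  then have "(down_op ^^ m) ((?U ^^ m) (\<lambda>z. down_op (?U f) z / rate \<theta> n)) x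
      = (down_op ^^ m) ((?U ^^ m) (down_op (?U f))) x / rate \<theta> n"
    using down_pow_linear[where b = 0 and a = "1 / rate \<theta> n" and f = "(?U ^^ m) (down_op (?U f))"] by simp
  also have "(down_op ^^ m) ((?U ^^ m) (down_op (?U f))) x
      = (down_op ^^ m) (\<lambda>z. 1 * down_op ((?U ^^ Suc m) f) z + (rate \<theta> n - rate \<theta> l) * (?U ^^ m) f z) x"
  proof (rule down_pow_cong[OF _ x])
    fix y assume y: "y \<in> partitions l"
    have "(rate \<theta> (l + m) - rate \<theta> l) * (?U ^^ (m - 1)) (?U f) y = (rate \<theta> n - rate \<theta> l) * (?U ^^ m) f y"
      unfolding n by (cases m) (auto simp: funpow_swap1)
    then show "(?U ^^ m) (down_op (?U f)) y
        = 1 * down_op ((?U ^^ Suc m) f) y + (rate \<theta> n - rate \<theta> l) * (?U ^^ m) f y"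
      by (subst up_pow_down_commute[OF y]) (simp add: funpow_swap1)
  qed
  also have "\<dots> = (down_op ^^ m) (down_op ((?U ^^ Suc m) f)) x
      + (rate \<theta> n - rate \<theta> l) * (down_op ^^ m) ((?U ^^ m) f) x"
    by (subst down_pow_linear) simp
  finally have eq: "level_op \<theta> \<alpha> n (\<lambda>z. down_op (?U f) z / rate \<theta> n) x l
      = (down_op ^^ m) (down_op ((?U ^^ Suc m) f)) x / (rate \<theta> n * ?P l)
        + (1 - rate \<theta> l / rate \<theta> n) * level_op \<theta> \<alpha> n f x l"
    using rn unfolding level_op_def m_def[symmetric]
    by (simp add: add_divide_distrib diff_divide_distrib left_diff_distrib)
  have "(down_op ^^ m) (down_op ((?U ^^ Suc m) f)) x / (rate \<theta> n * ?P l)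
      = rate \<theta> l / rate \<theta> n * level_op \<theta> \<alpha> n f x (l - 1)"
  \<comment> \<open>At \<open>l = 0\<close> there is no level below: \<open>down_op\<close> vanishes
    on the empty partition and so does \<open>rate \<theta> 0\<close>, hence the truncated
    \<open>l - 1\<close> does no harm.\<close>
  proof (cases "l = 0")
    case True
    \<comment> \<open>The zero function is written as a linear combination so that
      \<open>down_pow_linear\<close> evaluates it.\<close>
    have "(down_op ^^ m) (down_op ((?U ^^ Suc m) f)) x = (down_op ^^ m) (\<lambda>z. 0 * 0 + 0 * 0) x"
      by (rule down_pow_cong[OF _ x]) (simp add: True partitions_0 down_op_def)
    also have "\<dots> = 0" by (subst down_pow_linear) simp
    finally show ?thesis using True by simp
  next
    case False
    have "{l - 1<..n} = insert l {l<..n}" using False assms by auto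
    then have "?P (l - 1) = rate \<theta> l * ?P l" by simp
    moreover have "n - (l - 1) = Suc m" using False assms by (simp add: m_def)
    moreover have "rate \<theta> l > 0" using False assms by (simp add: rate_pos)
    ultimately show ?thesis using rn unfolding level_op_def
      by (simp add: funpow_swap1)
  qed
  then show ?thesis using eq by simp
qed

lemma level_op_top: "level_op \<theta> \<alpha> n f x n = f x"
  by (simp add: level_op_def)

lemma up_pow_nonneg:
  assumes "\<And>y. 0 \<notin># y \<Longrightarrow> f y \<ge> 0" "0 \<notin># x" "\<theta> > 0" "0 \<le> \<alpha>" "\<alpha> < 1"
  shows "(up_op \<theta> \<alpha> ^^ m) f x \<ge> 0"
  using assms(2)
proof (induction m arbitrary: x)
  case (Suc m)
  have "(\<Sum>k\<in>#x. (real k - \<alpha>) * (up_op \<theta> \<alpha> ^^ m) f (add_box k x)) \<ge> 0"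
    unfolding sum_mset_conv_count
  proof (intro sum_nonneg mult_nonneg_nonneg Suc.IH)
    fix k assume k: "k \<in># x"
    then have "k \<noteq> 0" using Suc.prems by metis
    then show "real k - \<alpha> \<ge> 0" using assms(5) by linarith
    show "0 \<notin># add_box k x" using Suc.prems by (auto simp: add_box_def dest: in_diffD)
  qed auto
  moreover have "(up_op \<theta> \<alpha> ^^ m) f (x + {#1#}) \<ge> 0"
    by (rule Suc.IH) (use Suc.prems in auto)
  ultimately show ?case using assms by (simp add: up_op_def[of \<theta> \<alpha> "(up_op \<theta> \<alpha> ^^ m) f"])
qed (use assms in auto)

lemma down_pow_nonneg:
  assumes "\<And>y. 0 \<notin># y \<Longrightarrow> f y \<ge> 0" "0 \<notin># x"
  shows "(down_op ^^ m) f x \<ge> 0"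
  using assms(2)
proof (induction m arbitrary: x)
  case (Suc m)
  have "(\<Sum>k\<in>#x. real k * (down_op ^^ m) f (remove_box k x)) \<ge> 0"
    unfolding sum_mset_conv_count
  proof (intro sum_nonneg mult_nonneg_nonneg Suc.IH)
    fix k assume k: "k \<in># x"
    then have "k \<noteq> 0" using Suc.prems by metis
    then show "0 \<notin># remove_box k x" using Suc.prems by (auto simp: remove_box_def dest: in_diffD)
  qed auto
  then show ?case by (simp add: down_op_def[of "(down_op ^^ m) f"])
qed (use assms in auto)

lemma level_op_nonneg:
  assumes "\<And>y. 0 \<notin># y \<Longrightarrow> f y \<ge> 0" "0 \<notin># x" "\<theta> > 0" "0 \<le> \<alpha>" "\<alpha> < 1"
  shows "level_op \<theta> \<alpha> n f x l \<ge> 0"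
  unfolding level_op_def
  by (intro divide_nonneg_nonneg down_pow_nonneg up_pow_nonneg prod_nonneg)
     (use assms in \<open>auto intro!: order.strict_implies_order[OF rate_pos]\<close>)

section \<open>The Pitman distribution, with the factor depending on \<open>n\<close> split off, and
  its detailed balance\<close>

definition weight :: "real \<Rightarrow> real \<Rightarrow> nat multiset \<Rightarrow> real" where
  "weight \<theta> \<alpha> x = (\<Prod>i<size x. \<theta> + real i * \<alpha>) / (\<Prod>k\<in>set_mset x. fact (count x k))
     * (\<Prod>p\<in>#x. (\<Prod>j\<in>{2..p}. real j - 1 - \<alpha>) / fact p)"

lemma prod_mset_divide:
  fixes f g :: "'a \<Rightarrow> real"
  shows "(\<Prod>p\<in>#x. f p / g p) = (\<Prod>p\<in>#x. f p) / (\<Prod>p\<in>#x. g p)"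
  by (induction x) auto

lemma pitman_conv_weight: "pitman \<theta> \<alpha> n x = fact n * weight \<theta> \<alpha> x / pochhammer \<theta> n"
  by (simp add: pitman_def weight_def prod_mset_divide mult_ac)

lemma weight_empty [simp]: "weight \<theta> \<alpha> {#} = 1"
  by (simp add: weight_def)

lemma prod_fact_count_add_mset:
  "(\<Prod>k\<in>set_mset (add_mset a x). fact (count (add_mset a x) k) :: real)
     = (real (count x a) + 1) * (\<Prod>k\<in>set_mset x. fact (count x k))"
proof -
  have "(\<Prod>k\<in>insert a (set_mset x). fact (count (add_mset a x) k) :: real)
      = (\<Prod>k\<in>insert a (set_mset x). fact (count x k) * (if k = a then real (count x a) + 1 else 1))"
    by (intro prod.cong) (auto simp: algebra_simps)
  also have "\<dots> = (\<Prod>k\<in>insert a (set_mset x). fact (count x k)) * (real (count x a) + 1)"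
    by (simp add: prod.distrib prod.delta)
  also have "(\<Prod>k\<in>insert a (set_mset x). fact (count x k) :: real) = (\<Prod>k\<in>set_mset x. fact (count x k))"
    by (rule prod.mono_neutral_right) (auto simp: not_in_iff)
  finally show ?thesis by simp
qed

lemma weight_add_mset:
  "weight \<theta> \<alpha> (add_mset a x) = weight \<theta> \<alpha> x * (\<theta> + \<alpha> * real (size x))
     * ((\<Prod>j\<in>{2..a}. real j - 1 - \<alpha>) / fact a) / (real (count x a) + 1)"
  unfolding weight_def prod_fact_count_add_mset by (simp add: mult_ac)

lemma weight_pos:
  assumes "\<theta> > 0" "0 \<le> \<alpha>" "\<alpha> < 1"
  shows "weight \<theta> \<alpha> x > 0"
proof (induction x)
  case (add a x)
  have "(\<Prod>j\<in>{2..a}. real j - 1 - \<alpha>) > 0"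
    by (rule prod_pos) (use assms in auto)
  moreover have "\<theta> + \<alpha> * real (size x) > 0"
    using assms by (intro add_pos_nonneg) auto
  moreover have "real (count x a) + 1 > 0" by linarith
  ultimately show ?case using add by (simp add: weight_add_mset)
qed simp

text \<open>Detailed balance along an edge, without normalising constants. Both sides reduce to the
  remaining rows \<open>w\<close>: lengthening the row multiplies its factor by
  \<open>(k - \<alpha>) / (k + 1)\<close>, and each multiplicity cancels the denominator in
  \<open>weight_add_mset\<close>. The edge that creates a part is
  \<open>weight_add_part\<close>.\<close>

lemma weight_add_box:
  assumes "k \<in># x" "k \<ge> 1"
  shows "weight \<theta> \<alpha> x * ((real k - \<alpha>) * real (count x k))
       = weight \<theta> \<alpha> (add_box k x) * (real (k + 1) * real (count (add_box k x) (k + 1)))"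
proof -
  obtain w where w: "x = add_mset k w" using assms(1) by (auto dest: multi_member_split)
  define g where "g = (\<Prod>j\<in>{2..k}. real j - 1 - \<alpha>)"
  define S where "S = weight \<theta> \<alpha> w * (\<theta> + \<alpha> * real (size w))"
  have "{2..k + 1} = insert (k + 1) {2..k}" using assms(2) by auto
  then have g: "(\<Prod>j\<in>{2..k + 1}. real j - 1 - \<alpha>) = (real k - \<alpha>) * g"
    by (simp add: g_def)
  have c: "real (count w k) + 1 \<noteq> 0" "real (count w (k + 1)) + 1 \<noteq> 0"
    by linarith+
  have box: "add_box k x = add_mset (k + 1) w" by (simp add: w add_box_def)
  have "weight \<theta> \<alpha> x * ((real k - \<alpha>) * real (count x k)) = S * (real k - \<alpha>) * g / fact k"
    using c by (simp add: w weight_add_mset S_def g_def[symmetric] add.commute)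
  moreover have "weight \<theta> \<alpha> (add_box k x) * (real (k + 1) * real (count (add_box k x) (k + 1)))
      = S * ((real k - \<alpha>) * g / fact (k + 1)) * real (k + 1)"
    unfolding box weight_add_mset g S_def[symmetric] using c by (simp add: add.commute)
  moreover have "fact (k + 1) = real (k + 1) * fact k" by simp
  ultimately show ?thesis by (simp del: of_nat_Suc of_nat_add fact_Suc)
qed

lemma weight_add_part:
  "weight \<theta> \<alpha> x * (\<theta> + \<alpha> * real (size x))
     = weight \<theta> \<alpha> (x + {#1#}) * real (count (x + {#1#}) 1)"
proof -
  have "real (count x (Suc 0)) + 1 \<noteq> 0" by linarith
  then show ?thesis by (simp add: weight_add_mset field_simps)
qed

text \<open>Detailed balance summed over all edges between levels \<open>n\<close> and
  \<open>n + 1\<close>. Grouped by lower end the sum is the left side; grouped by upper end each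
  \<open>y\<close> collects the sum of \<open>j * m_j(y)\<close>, which is
  \<open>n + 1\<close>.\<close>

lemma sum_weight_up_op:
  "(\<Sum>x\<in>partitions n. weight \<theta> \<alpha> x * up_op \<theta> \<alpha> f x)
     = real (n + 1) * (\<Sum>y\<in>partitions (n + 1). weight \<theta> \<alpha> y * f y)"
proof -
  \<comment> \<open>The up weights, with a new part treated as a box added to a row of length
    0.\<close>
  define u where "u x k = (if k = 0 then \<theta> + \<alpha> * real (size x) else (real k - \<alpha>) * real (count x k))"
    for x :: "nat multiset" and k
  let ?W = "weight \<theta> \<alpha>"
  have up: "up_op \<theta> \<alpha> f x = (\<Sum>k\<in>insert 0 (set_mset x). u x k * f (add_box k x))"
    if "x \<in> partitions n" for x
  proof -
    have 0: "0 \<notin># x" using that by (rule partitionsD)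
    then have "(\<Sum>k\<in>set_mset x. u x k * f (add_box k x))
        = (\<Sum>k\<in>#x. (real k - \<alpha>) * f (add_box k x))"
      unfolding sum_mset_conv_count by (intro sum.cong) (auto simp: u_def)
    then show ?thesis using 0 by (simp add: up_op_def u_def add_box_0)
  qed
  have "(\<Sum>x\<in>partitions n. ?W x * up_op \<theta> \<alpha> f x)
      = (\<Sum>x\<in>partitions n. \<Sum>k\<in>insert 0 (set_mset x). ?W x * u x k * f (add_box k x))"
    by (intro sum.cong refl) (simp add: up sum_distrib_left mult.assoc del: sum.insert)
  also have "\<dots> = (\<Sum>(x, k)\<in>(SIGMA x:partitions n. insert 0 (set_mset x)). ?W x * u x k * f (add_box k x))"
    by (rule sum.Sigma) (auto simp: finite_partitions)
  \<comment> \<open>The edge \<open>(x, k)\<close> is renamed by its upper end \<open>y\<close> and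
    the length \<open>j = k + 1\<close> of the grown row.\<close>
  also have "\<dots> = (\<Sum>(y, j)\<in>(SIGMA y:partitions (n + 1). set_mset y). ?W y * (real j * real (count y j)) * f y)"
  proof (rule sum.reindex_bij_witness[where i = "\<lambda>(y, j). (remove_box j y, j - 1)"
        and j = "\<lambda>(x, k). (add_box k x, k + 1)"])
    fix a assume "a \<in> (SIGMA x:partitions n. insert 0 (set_mset x))"
    then obtain x k where a: "a = (x, k)" "x \<in> partitions n" "k \<in> insert 0 (set_mset x)" by auto
    have 0: "0 \<notin># x" using a(2) by (rule partitionsD)
    show "(case case a of (x, k) \<Rightarrow> (add_box k x, k + 1) of (y, j) \<Rightarrow> (remove_box j y, j - 1)) = a"
      using remove_box_add_box[OF 0 a(3)] by (simp add: a(1))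
    have "add_box k x \<in> partitions (n + 1)"
      using a(2,3) add_box_in_partitions add_part_in_partitions add_box_0[OF 0] by (cases "k = 0") auto
    then show "(case a of (x, k) \<Rightarrow> (add_box k x, k + 1)) \<in> (SIGMA y:partitions (n + 1). set_mset y)"
      by (simp add: a(1) add_box_def)
    have "?W x * u x k = ?W (add_box k x) * (real (k + 1) * real (count (add_box k x) (k + 1)))"
    proof (cases "k = 0")
      case True
      then show ?thesis using weight_add_part[of \<theta> \<alpha> x] by (simp add: u_def add_box_0[OF 0])
    next
      case False
      then show ?thesis using weight_add_box[of k x \<theta> \<alpha>] a(3) by (simp add: u_def)
    qed
    then show "(case case a of (x, k) \<Rightarrow> (add_box k x, k + 1) of
          (y, j) \<Rightarrow> ?W y * (real j * real (count y j)) * f y)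
        = (case a of (x, k) \<Rightarrow> ?W x * u x k * f (add_box k x))"
      by (simp add: a(1))
  next
    fix b assume "b \<in> (SIGMA y:partitions (n + 1). set_mset y)"
    then obtain y j where b: "b = (y, j)" "y \<in> partitions (n + 1)" "j \<in># y" by auto
    have 0: "0 \<notin># y" using b(2) by (rule partitionsD)
    have j: "j \<noteq> 0" using b(3) 0 by metis
    show "(case case b of (y, j) \<Rightarrow> (remove_box j y, j - 1) of (x, k) \<Rightarrow> (add_box k x, k + 1)) = b"
      using add_box_remove_box[OF 0 b(3)] j by (simp add: b(1))
    show "(case b of (y, j) \<Rightarrow> (remove_box j y, j - 1)) \<in> (SIGMA x:partitions n. insert 0 (set_mset x))"
      using remove_box_in_partitions[of y n j] b j by (auto simp: remove_box_def)
  qed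
  also have "\<dots> = (\<Sum>y\<in>partitions (n + 1). \<Sum>j\<in>set_mset y. ?W y * (real j * real (count y j)) * f y)"
    by (rule sum.Sigma[symmetric]) (auto simp: finite_partitions)
  also have "\<dots> = (\<Sum>y\<in>partitions (n + 1). real (n + 1) * (?W y * f y))"
  proof (intro sum.cong refl)
    fix y assume y: "y \<in> partitions (n + 1)"
    have "(\<Sum>j\<in>set_mset y. real (count y j) * real j) = real (sum_mset y)"
      unfolding sum_mset_conv_count[symmetric] by (induction y) auto
    then have "(\<Sum>j\<in>set_mset y. real j * real (count y j)) = real (n + 1)"
      using partitionsD(2)[OF y] by (simp add: mult.commute)
    then show "(\<Sum>j\<in>set_mset y. ?W y * (real j * real (count y j)) * f y) = real (n + 1) * (?W y * f y)"
      by (simp add: sum_distrib_left[symmetric] sum_distrib_right[symmetric])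
  qed
  finally show ?thesis by (simp add: sum_distrib_left)
qed

lemma up_pow_empty:
  "(up_op \<theta> \<alpha> ^^ n) f {#} = fact n * (\<Sum>y\<in>partitions n. weight \<theta> \<alpha> y * f y)"
proof (induction n arbitrary: f)
  case 0
  then show ?case by (simp add: partitions_0)
next
  case (Suc n)
  have "(up_op \<theta> \<alpha> ^^ Suc n) f {#} = (up_op \<theta> \<alpha> ^^ n) (up_op \<theta> \<alpha> f) {#}"
    by (simp add: funpow_swap1)
  then show ?case by (simp add: Suc.IH sum_weight_up_op)
qed

lemma down_pow_full:
  assumes "x \<in> partitions n"
  shows "(down_op ^^ n) g x = fact n * g {#}"
  using assms
proof (induction n arbitrary: x)
  case (Suc n)
  have "(down_op ^^ Suc n) g x = down_op (\<lambda>_. fact n * g {#}) x"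
    using down_op_cong[OF Suc.IH Suc.prems] by simp
  also have "\<dots> = real (sum_mset x) * (fact n * g {#})"
    unfolding down_op_def by (induction x) (auto simp: algebra_simps)
  finally show ?case using partitionsD(2)[OF Suc.prems] by simp
qed (simp add: partitions_0)

lemma prod_rate: "(\<Prod>k\<in>{0<..n}. rate \<theta> k) = fact n * pochhammer \<theta> n"
proof (induction n)
  case (Suc n)
  have "{0<..Suc n} = insert (Suc n) {0<..n}" by auto
  then show ?case using Suc by (simp add: rate_def pochhammer_Suc algebra_simps)
qed simp

text \<open>Level 0 holds only the empty partition, so the start is forgotten. The descent and the
  ascent give \<open>n!\<close> each, and dividing by \<open>n! * pochhammer \<theta> n\<close>
  turns the weight into \<open>pitman\<close>.\<close>

lemma level_op_0:
  assumes "x \<in> partitions n"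
  shows "level_op \<theta> \<alpha> n f x 0 = (\<Sum>y\<in>partitions n. pitman \<theta> \<alpha> n y * f y)"
  using assms
  by (simp add: level_op_def down_pow_full up_pow_empty prod_rate pitman_conv_weight
      sum_distrib_left sum_divide_distrib mult_ac)

text \<open>The only partition of 1 is \<open>{#1#}\<close>. Stepping from it to level 0 and back
  has weight \<open>\<theta> = rate \<theta> 1\<close>, exactly the extra factor in the product of
  rates.\<close>

lemma level_op_1:
  assumes "\<theta> > 0" "n \<ge> 1" "x \<in> partitions n"
  shows "level_op \<theta> \<alpha> n f x 1 = level_op \<theta> \<alpha> n f x 0"
proof -
  obtain m where n: "n = Suc m" using assms by (cases n) auto
  define g where "g = (up_op \<theta> \<alpha> ^^ m) f"
  have "(down_op ^^ m) (down_op (up_op \<theta> \<alpha> g)) x = (down_op ^^ m) (\<lambda>z. \<theta> * g z + 0 * g z) x"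
  proof (rule down_pow_cong[of 1])
    fix y assume y: "y \<in> partitions 1"
    then have "y \<noteq> {#}" by (auto simp: partitions_def)
    then obtain j where j: "j \<in># y" by auto
    have "remove_box j y \<in> partitions 0" using y j remove_box_in_partitions by auto
    then have "y = add_box (j - 1) {#}"
      using add_box_remove_box[OF partitionsD(1)[OF y] j] by (simp add: partitions_0)
    then have "y = {#1#}" using partitionsD(2)[OF y] by (simp add: add_box_def)
    then show "down_op (up_op \<theta> \<alpha> g) y = \<theta> * g y + 0 * g y"
      by (simp add: down_op_def up_op_def remove_box_def)
  qed (use assms n in auto)
  also have "\<dots> = \<theta> * (down_op ^^ m) g x" by (subst down_pow_linear) simp
  finally have "(down_op ^^ Suc m) ((up_op \<theta> \<alpha> ^^ Suc m) f) x = \<theta> * (down_op ^^ m) g x"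
    by (simp add: g_def funpow_swap1)
  moreover have "{0<..n} = insert 1 {1<..n}" using assms by auto
  moreover have "rate \<theta> 1 = \<theta>" by (simp add: rate_def)
  ultimately show ?thesis using assms unfolding level_op_def by (simp add: n g_def)
qed

section \<open>Separation distance\<close>

text \<open>Interchanging the sums leaves one target for each part size, and the multiplicity turns
  the sum over sizes into one over occurrences.\<close>

lemma sum_down_prob:
  assumes "x \<in> partitions (Suc n)"
  shows "(\<Sum>z\<in>partitions n. down_prob x z * g z) = down_op g x / real (Suc n)"
proof -
  have s: "sum_mset x = Suc n" using assms by (rule partitionsD)
  have "(\<Sum>z\<in>partitions n. down_prob x z * g z)
      = (\<Sum>z\<in>partitions n. \<Sum>j\<in>set_mset x. if z = remove_box j x
          then real j * real (count x j) / real (Suc n) * g (remove_box j x) else 0)"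
    by (auto simp: down_prob_def s sum_distrib_right intro!: sum.cong)
  also have "\<dots> = (\<Sum>j\<in>set_mset x. real j * real (count x j) / real (Suc n) * g (remove_box j x))"
    by (subst sum.swap) (use assms remove_box_in_partitions finite_partitions in \<open>auto intro!: sum.cong\<close>)
  finally show ?thesis
    by (simp add: down_op_def sum_mset_conv_count sum_divide_distrib mult_ac)
qed

lemma sum_up_prob:
  assumes "x \<in> partitions n"
  shows "(\<Sum>z\<in>partitions (Suc n). up_prob \<theta> \<alpha> x z * g z) = up_op \<theta> \<alpha> g x / (\<theta> + real n)"
proof -
  have s: "sum_mset x = n" using assms by (rule partitionsD)
  have "(\<Sum>z\<in>partitions (Suc n). up_prob \<theta> \<alpha> x z * g z)
      = (\<Sum>z\<in>partitions (Suc n). (\<Sum>k\<in>set_mset x. if z = add_box k x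
          then (real k - \<alpha>) * real (count x k) / (\<theta> + real n) * g (add_box k x) else 0)
        + (if z = x + {#1#} then (\<theta> + \<alpha> * real (size x)) / (\<theta> + real n) * g (x + {#1#}) else 0))"
    by (auto simp: up_prob_def s sum_distrib_right distrib_right
        intro!: sum.cong arg_cong2[where f = "(+)"])
  also have "\<dots> = (\<Sum>k\<in>set_mset x. (real k - \<alpha>) * real (count x k) / (\<theta> + real n) * g (add_box k x))
      + (\<theta> + \<alpha> * real (size x)) / (\<theta> + real n) * g (x + {#1#})"
    unfolding sum.distrib
    by (subst sum.swap)
       (use assms add_box_in_partitions add_part_in_partitions[OF assms] finite_partitions in
         \<open>auto intro!: sum.cong\<close>)
  finally show ?thesis
    by (simp add: up_op_def sum_mset_conv_count sum_divide_distrib add_divide_distrib distrib_left mult_ac)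
qed

lemma sum_down_up:
  assumes "n \<ge> 1" "x \<in> partitions n"
  shows "(\<Sum>y\<in>partitions n. down_up \<theta> \<alpha> n x y * f y) = down_op (up_op \<theta> \<alpha> f) x / rate \<theta> n"
proof -
  obtain m where n: "n = Suc m" using assms by (cases n) auto
  have "(\<Sum>y\<in>partitions n. down_up \<theta> \<alpha> n x y * f y)
      = (\<Sum>z\<in>partitions m. down_prob x z * (\<Sum>y\<in>partitions n. up_prob \<theta> \<alpha> z y * f y))"
    unfolding down_up_def sum_distrib_left sum_distrib_right
    by (subst sum.swap) (simp add: n mult.assoc)
  also have "\<dots> = (\<Sum>z\<in>partitions m. down_prob x z * up_op \<theta> \<alpha> f z) / (\<theta> + real m)"
    unfolding sum_divide_distrib by (intro sum.cong refl) (simp add: sum_up_prob n)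
  also have "\<dots> = down_op (up_op \<theta> \<alpha> f) x / rate \<theta> n"
    using assms by (simp add: sum_down_prob n rate_def)
  finally show ?thesis .
qed

section \<open>The death chain and the mixture formula for powers of the walk\<close>

text \<open>The expectation of \<open>q\<close> after \<open>r\<close> steps of the pure death chain started at \<open>n\<close> that
  moves from \<open>l\<close> to \<open>l - 1\<close> with probability \<open>rate \<theta> l / rate \<theta> n\<close>.\<close>

primrec death_exp :: "real \<Rightarrow> nat \<Rightarrow> nat \<Rightarrow> (nat \<Rightarrow> real) \<Rightarrow> real" where
  "death_exp \<theta> n 0 q = q n"
| "death_exp \<theta> n (Suc r) q = death_exp \<theta> n r
     (\<lambda>l. rate \<theta> l / rate \<theta> n * q (l - 1) + (1 - rate \<theta> l / rate \<theta> n) * q l)"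

lemma death_exp_cong:
  assumes "\<And>l. l \<le> n \<Longrightarrow> p l = q l"
  shows "death_exp \<theta> n r p = death_exp \<theta> n r q"
  using assms
proof (induction r arbitrary: p q)
  case (Suc r)
  show ?case unfolding death_exp.simps by (rule Suc.IH) (simp add: Suc.prems)
qed simp

text \<open>For \<open>l <= n\<close> the ratio \<open>rate \<theta> l / rate \<theta> n\<close>
  lies between 0 and 1, so each step takes a convex combination.\<close>

lemma death_exp_mono:
  assumes "\<theta> > 0" "n \<ge> 1" "\<And>l. l \<le> n \<Longrightarrow> p l \<le> q l"
  shows "death_exp \<theta> n r p \<le> death_exp \<theta> n r q"
  using assms(3)
proof (induction r arbitrary: p q)
  case (Suc r)
  have pos: "rate \<theta> n > 0" using assms rate_pos by blast
  show ?case unfolding death_exp.simps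
  proof (rule Suc.IH)
    fix l assume l: "l \<le> n"
    have "rate \<theta> l \<ge> 0" using assms(1) rate_pos[of \<theta> l] by (cases "l = 0") auto
    then show "rate \<theta> l / rate \<theta> n * p (l - 1) + (1 - rate \<theta> l / rate \<theta> n) * p l
        \<le> rate \<theta> l / rate \<theta> n * q (l - 1) + (1 - rate \<theta> l / rate \<theta> n) * q l"
      using l pos rate_mono[OF assms(1) l] Suc.prems[of l] Suc.prems[of "l - 1"]
      by (intro add_mono mult_left_mono) auto
  qed
qed simp

lemma death_exp_linear:
  "death_exp \<theta> n r (\<lambda>l. a * p l + b * q l) = a * death_exp \<theta> n r p + b * death_exp \<theta> n r q"
proof (induction r arbitrary: p q)
  case (Suc r)
  show ?case unfolding death_exp.simps Suc.IH[symmetric]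
    by (intro death_exp_cong) (simp add: algebra_simps add_divide_distrib)
qed simp

lemma death_exp_const: "death_exp \<theta> n r (\<lambda>_. c) = c"
  by (induction r) (simp_all add: algebra_simps)

text \<open>The last step of the walk is absorbed into \<open>f\<close>, hence the induction over
  arbitrary \<open>f\<close>; \<open>level_op_step\<close> then trades it for a step of the death
  chain. At time 0 the level is \<open>n\<close>, whose kernel is the identity.\<close>

lemma sum_down_up_pow:
  assumes "\<theta> > 0" "n \<ge> 1" "x \<in> partitions n"
  shows "(\<Sum>y\<in>partitions n. down_up_pow \<theta> \<alpha> n r x y * f y)
       = death_exp \<theta> n r (level_op \<theta> \<alpha> n f x)"
proof (induction r arbitrary: f)
  case 0
  then show ?case using assms by (simp add: level_op_top finite_partitions if_distrib[of "\<lambda>t. t * _"] cong: if_cong)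
next
  case (Suc r)
  let ?K = "\<lambda>z. down_op (up_op \<theta> \<alpha> f) z / rate \<theta> n"
  have "(\<Sum>y\<in>partitions n. down_up_pow \<theta> \<alpha> n (Suc r) x y * f y)
      = (\<Sum>z\<in>partitions n. down_up_pow \<theta> \<alpha> n r x z * (\<Sum>y\<in>partitions n. down_up \<theta> \<alpha> n z y * f y))"
    unfolding down_up_pow.simps sum_distrib_left sum_distrib_right
    by (subst sum.swap) (simp add: mult.assoc)
  also have "\<dots> = (\<Sum>z\<in>partitions n. down_up_pow \<theta> \<alpha> n r x z * ?K z)"
    by (intro sum.cong refl) (simp only: sum_down_up[OF assms(2)])
  also have "\<dots> = death_exp \<theta> n r (level_op \<theta> \<alpha> n ?K x)" by (rule Suc.IH)
  also have "\<dots> = death_exp \<theta> n (Suc r) (level_op \<theta> \<alpha> n f x)"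
    unfolding death_exp.simps
    by (intro death_exp_cong level_op_step) (use assms in auto)
  finally show ?case .
qed

lemma down_up_pow_conv_death_exp:
  assumes "\<theta> > 0" "n \<ge> 1" "x \<in> partitions n" "y \<in> partitions n"
  shows "down_up_pow \<theta> \<alpha> n r x y = death_exp \<theta> n r (level_op \<theta> \<alpha> n (\<lambda>z. if z = y then 1 else 0) x)"
  using sum_down_up_pow[OF assms(1-3), of \<alpha> r "\<lambda>z. if z = y then 1 else 0"] assms(4)
  by (simp add: finite_partitions if_distrib[of "\<lambda>t. _ * t"] cong: if_cong)

section \<open>Kernels at low levels, the extremal pair and the maximal separation\<close>

lemma level_op_le_1:
  assumes "\<theta> > 0" "n \<ge> 1" "x \<in> partitions n" "y \<in> partitions n" "l \<le> 1"
  shows "level_op \<theta> \<alpha> n (\<lambda>z. if z = y then 1 else 0) x l = pitman \<theta> \<alpha> n y"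
proof -
  have "level_op \<theta> \<alpha> n (\<lambda>z. if z = y then 1 else 0) x 0 = pitman \<theta> \<alpha> n y"
    using assms by (simp add: level_op_0 finite_partitions if_distrib[of "\<lambda>t. _ * t"] cong: if_cong)
  moreover have "l = 0 \<or> l = 1" using assms(5) by linarith
  ultimately show ?thesis using level_op_1 assms by metis
qed

text \<open>Up steps never shorten a row, so a row of length at least 2 survives until
  \<open>f\<close> is evaluated.\<close>

lemma up_pow_eq_0:
  assumes "\<And>y. \<exists>p\<in>#y. p \<ge> 2 \<Longrightarrow> f y = 0" "\<exists>p\<in>#x. p \<ge> 2"
  shows "(up_op \<theta> \<alpha> ^^ m) f x = 0"
  using assms(2)
proof (induction m arbitrary: x)
  case (Suc m)
  have "(up_op \<theta> \<alpha> ^^ m) f (add_box k x) = 0" if "k \<in># x" for k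
  proof (rule Suc.IH)
    obtain p where p: "p \<in># x" "p \<ge> 2" using Suc.prems by auto
    show "\<exists>p\<in>#add_box k x. p \<ge> 2"
    proof (cases "p = k")
      case True
      then show ?thesis using p by (auto simp: add_box_def)
    next
      case False
      then have "p \<in># add_box k x" using p by (simp add: add_box_def in_diff_count)
      then show ?thesis using p by blast
    qed
  qed
  moreover have "(up_op \<theta> \<alpha> ^^ m) f (x + {#1#}) = 0"
    by (rule Suc.IH) (use Suc.prems in auto)
  ultimately show ?case
    by (simp add: up_op_def[of \<theta> \<alpha> "(up_op \<theta> \<alpha> ^^ m) f"] cong: image_mset_cong)
qed (use assms in auto)

text \<open>A single row can only be shortened, so \<open>m\<close> removals lead from
  \<open>{#n#}\<close> to \<open>{#n - m#}\<close> and nowhere else.\<close>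

lemma down_pow_singleton_eq_0:
  assumes "m < n" "g {#n - m#} = 0"
  shows "(down_op ^^ m) g {#n#} = 0"
  using assms
proof (induction m arbitrary: n)
  case (Suc m)
  then have "(down_op ^^ m) g {#n - 1#} = 0" by (intro Suc.IH) auto
  then show ?case using Suc.prems
    by (simp add: down_op_def[of "(down_op ^^ m) g"] remove_box_def)
qed simp

lemma level_op_extremal:
  assumes "2 \<le> l" "l \<le> n"
  shows "level_op \<theta> \<alpha> n (\<lambda>z. if z = replicate_mset n 1 then 1 else 0) {#n#} l = 0"
proof -
  have "(up_op \<theta> \<alpha> ^^ (n - l)) (\<lambda>z. if z = replicate_mset n 1 then 1 else 0) {#n - (n - l)#} = 0"
    by (rule up_pow_eq_0) (use assms in \<open>auto split: if_splits\<close>)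
  then show ?thesis using assms
    by (simp add: level_op_def down_pow_singleton_eq_0)
qed

lemma pitman_pos:
  assumes "\<theta> > 0" "0 \<le> \<alpha>" "\<alpha> < 1"
  shows "pitman \<theta> \<alpha> n x > 0"
  using weight_pos[OF assms] pochhammer_pos[OF assms(1)] by (simp add: pitman_conv_weight)

text \<open>For every pair the level kernel is \<open>pitman\<close> at levels 0 and 1 and
  nonnegative above, so \<open>K^r(x,y)\<close> is at least \<open>pitman\<close> of
  \<open>y\<close> times \<open>1 - s\<close>, with \<open>s\<close> the death chain's survival
  probability. For a single row and \<open>n\<close> rows of length 1 the kernel is 0 above level 1,
  and equality holds.\<close>

lemma max_separation_conv_death_exp:
  assumes "\<theta> > 0" "0 \<le> \<alpha>" "\<alpha> < 1" "n \<ge> 1"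
  shows "max_separation \<theta> \<alpha> n r = death_exp \<theta> n r (\<lambda>l. if l \<ge> 2 then 1 else 0)"
proof -
  let ?s = "death_exp \<theta> n r (\<lambda>l. if l \<ge> 2 then 1 else 0)"
  let ?\<delta> = "\<lambda>y z. if z = y then 1 else (0::real)"
  let ?S = "{1 - down_up_pow \<theta> \<alpha> n r x y / pitman \<theta> \<alpha> n y | x y.
            x \<in> partitions n \<and> y \<in> partitions n}"
  \<comment> \<open>The integrand is \<open>c\<close> times the indicator of levels at most 1, in
    the form \<open>death_exp_linear\<close> accepts.\<close>
  have lin: "death_exp \<theta> n r (\<lambda>l. c * 1 + (- c) * (if l \<ge> 2 then 1 else 0)) = c * (1 - ?s)" for c
    by (subst death_exp_linear) (simp add: death_exp_const algebra_simps)
  have "?S = (\<lambda>(x, y). 1 - down_up_pow \<theta> \<alpha> n r x y / pitman \<theta> \<alpha> n y) ` (partitions n \<times> partitions n)"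
    by auto
  then have "finite ?S" by (simp add: finite_partitions)
  moreover have "t \<le> ?s" if t_in: "t \<in> ?S" for t
  proof -
    obtain x y where t: "t = 1 - down_up_pow \<theta> \<alpha> n r x y / pitman \<theta> \<alpha> n y"
      and xy: "x \<in> partitions n" "y \<in> partitions n" using t_in by auto
    let ?c = "pitman \<theta> \<alpha> n y"
    have "?c * (1 - ?s) \<le> death_exp \<theta> n r (level_op \<theta> \<alpha> n (?\<delta> y) x)"
      unfolding lin[symmetric]
    proof (rule death_exp_mono)
      fix l assume "l \<le> n"
      show "?c * 1 + (- ?c) * (if l \<ge> 2 then 1 else 0) \<le> level_op \<theta> \<alpha> n (?\<delta> y) x l"
      proof (cases "l \<ge> 2")
        case True
        then show ?thesis using level_op_nonneg[of "?\<delta> y" x] partitionsD(1)[OF xy(1)] assms by simp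
      next
        case False
        then show ?thesis using level_op_le_1[OF assms(1,4) xy, of l] by simp
      qed
    qed (use assms in auto)
    then have "?c * (1 - ?s) \<le> down_up_pow \<theta> \<alpha> n r x y"
      using assms xy by (simp add: down_up_pow_conv_death_exp)
    then show ?thesis using pitman_pos[OF assms(1-3), of n y] by (simp add: t field_simps)
  qed
  moreover have "?s \<in> ?S"
  proof -
    let ?x = "{#n#}" and ?y = "replicate_mset n (1::nat)"
    let ?c = "pitman \<theta> \<alpha> n ?y"
    have xy: "?x \<in> partitions n" "?y \<in> partitions n"
      using assms(4) by (auto simp: partitions_def)
    have "down_up_pow \<theta> \<alpha> n r ?x ?y = death_exp \<theta> n r (level_op \<theta> \<alpha> n (?\<delta> ?y) ?x)"
      using assms xy by (simp add: down_up_pow_conv_death_exp)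
    also have "\<dots> = ?c * (1 - ?s)"
      unfolding lin[symmetric]
    proof (rule death_exp_cong)
      fix l assume l: "l \<le> n"
      show "level_op \<theta> \<alpha> n (?\<delta> ?y) ?x l = ?c * 1 + (- ?c) * (if l \<ge> 2 then 1 else 0)"
      proof (cases "l \<ge> 2")
        case True
        then show ?thesis using level_op_extremal[OF True l] by simp
      next
        case False
        then show ?thesis using level_op_le_1[OF assms(1,4) xy, of l] by simp
      qed
    qed
    finally have "?s = 1 - down_up_pow \<theta> \<alpha> n r ?x ?y / ?c"
      using pitman_pos[OF assms(1-3), of n ?y] by simp
    then show ?thesis using xy by blast
  qed
  ultimately show ?thesis unfolding max_separation_def by (intro Max_eqI) auto
qed

text \<open>\<open>h l\<close> is the mean time the death chain needs from \<open>l\<close> to leave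
  the levels above 1. One step lowers the expectation of \<open>h\<close> by the probability of
  still being there, so the sum telescopes.\<close>

lemma sum_separation:
  assumes "\<theta> > 0" "n \<ge> 1"
  defines "h \<equiv> \<lambda>l. \<Sum>i\<in>{2..l}. rate \<theta> n / rate \<theta> i"
  shows "(\<Sum>r<R. death_exp \<theta> n r (\<lambda>l. if l \<ge> 2 then 1 else 0)) = h n - death_exp \<theta> n R h"
proof (induction R)
  case (Suc R)
  have "death_exp \<theta> n (Suc R) h = death_exp \<theta> n R (\<lambda>l. 1 * h l + (- 1) * (if l \<ge> 2 then 1 else 0))"
    unfolding death_exp.simps
  proof (rule death_exp_cong)
    fix l assume "l \<le> n"
    show "rate \<theta> l / rate \<theta> n * h (l - 1) + (1 - rate \<theta> l / rate \<theta> n) * h l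
        = 1 * h l + (- 1) * (if l \<ge> 2 then 1 else 0)"
    proof (cases "l \<ge> 2")
      case True
      have "{2..l} = insert l {2..l - 1}" using True by auto
      then have "h l = rate \<theta> n / rate \<theta> l + h (l - 1)" using True by (simp add: h_def)
      moreover have "rate \<theta> l > 0" "rate \<theta> n > 0" using True assms rate_pos by auto
      ultimately show ?thesis using True by (simp add: field_simps)
    next
      case False
      then have "h l = 0" "h (l - 1) = 0" by (auto simp: h_def)
      then show ?thesis using False by simp
    qed
  qed
  then show ?case using Suc by (simp add: death_exp_linear[of \<theta> n R 1 h "-1", simplified])
qed simp

lemma sep_mixing_time_bounds:
  assumes "\<theta> > 0" "0 \<le> \<alpha>" "\<alpha> < 1" "n \<ge> 1"
  defines "E \<equiv> \<Sum>i\<in>{2..n}. rate \<theta> n / rate \<theta> i"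
  shows "E / 2 \<le> real (sep_mixing_time \<theta> \<alpha> n)" "real (sep_mixing_time \<theta> \<alpha> n) \<le> 2 * E"
proof -
  define s where "s = (\<lambda>r. death_exp \<theta> n r (\<lambda>l. if l \<ge> 2 then 1 else 0))"
  define h where "h = (\<lambda>l. \<Sum>i\<in>{2..l}. rate \<theta> n / rate \<theta> i)"
  have E: "E = h n" by (simp add: E_def h_def)
  have sum: "(\<Sum>r<R. s r) = E - death_exp \<theta> n R h" for R
    unfolding E s_def h_def using sum_separation[OF assms(1,4)] .
  have ratio_nonneg: "rate \<theta> n / rate \<theta> i \<ge> 0" if "i \<ge> 2" for i
    using that assms rate_pos[of \<theta> n] rate_pos[of \<theta> i] by auto
  have h0: "h l \<ge> 0" for l unfolding h_def by (intro sum_nonneg ratio_nonneg) auto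
  have hn: "h l \<le> h n" if "l \<le> n" for l
    unfolding h_def using that by (intro sum_mono2 ratio_nonneg) auto
  have le: "(\<Sum>r<R. s r) \<le> E" for R
  proof -
    have "death_exp \<theta> n R (\<lambda>_. 0) \<le> death_exp \<theta> n R h"
      by (rule death_exp_mono) (use assms h0 in auto)
    then show ?thesis by (simp add: sum death_exp_const)
  qed
  have mix: "sep_mixing_time \<theta> \<alpha> n = (LEAST r. s r \<le> 1 / 2)"
    unfolding sep_mixing_time_def s_def using assms by (simp add: max_separation_conv_death_exp)
  have lower: "real R / 2 \<le> E" if "\<And>r. r < R \<Longrightarrow> s r > 1 / 2" for R
  proof -
    have "(\<Sum>r<R. 1 / 2) \<le> (\<Sum>r<R. s r)"
      by (intro sum_mono) (use that in \<open>auto intro: less_imp_le\<close>)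
    then show ?thesis using le[of R] by simp
  qed
  \<comment> \<open>Were \<open>s\<close> above 1/2 forever, \<open>lower\<close> would bound every
    \<open>R\<close> by \<open>2 * E\<close>. So \<open>LEAST\<close> picks an actual time.\<close>
  have ex: "\<exists>r. s r \<le> 1 / 2"
  proof (rule ccontr)
    assume "\<not> (\<exists>r. s r \<le> 1 / 2)"
    then have "real R / 2 \<le> E" for R by (intro lower) (auto simp: not_le)
    from this[of "nat \<lceil>2 * E\<rceil> + 1"] show False
      using real_nat_ceiling_ge[of "2 * E"] by simp
  qed
  define R where "R = (LEAST r. s r \<le> 1 / 2)"
  have sR: "s R \<le> 1 / 2" unfolding R_def using ex by (rule LeastI_ex)
  have "s r > 1 / 2" if "r < R" for r
    using not_less_Least[of r "\<lambda>r. s r \<le> 1 / 2"] that by (auto simp: R_def)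
  then have "real R / 2 \<le> E" by (rule lower)
  then show "real (sep_mixing_time \<theta> \<alpha> n) \<le> 2 * E" by (simp add: mix R_def)
  \<comment> \<open>The mean remaining time is at most \<open>E\<close> before absorption and 0
    afterwards, hence at most \<open>E * s R\<close> on average. With \<open>s R <= 1/2\<close>, at
    least half of \<open>E\<close> is accumulated before time \<open>R\<close>, at most 1 per
    step.\<close>
  have "death_exp \<theta> n R h \<le> death_exp \<theta> n R (\<lambda>l. E * (if l \<ge> 2 then 1 else 0) + 0 * 0)"
    by (rule death_exp_mono) (use assms hn in \<open>auto simp: E h_def\<close>)
  also have "\<dots> = E * s R" by (subst death_exp_linear) (simp add: s_def)
  also have "\<dots> \<le> E * (1 / 2)"
    using sR h0[of n] by (intro mult_left_mono) (auto simp: E)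
  finally have "E / 2 \<le> (\<Sum>r<R. s r)" by (simp add: sum)
  also have "\<dots> \<le> (\<Sum>r<R. 1)"
  proof (rule sum_mono)
    fix r
    have "death_exp \<theta> n r (\<lambda>l. if l \<ge> 2 then 1 else 0) \<le> death_exp \<theta> n r (\<lambda>_. 1)"
      by (rule death_exp_mono) (use assms in auto)
    then show "s r \<le> 1" by (simp add: s_def death_exp_const)
  qed
  finally show "E / 2 \<le> real (sep_mixing_time \<theta> \<alpha> n)" by (simp add: mix R_def)
qed

section \<open>The sum of geometric variables\<close>

text \<open>The event is split by the values \<open>t + 1 + i\<close> and summed as a geometric
  series. At \<open>t = 0\<close> the result says that \<open>X\<close> is almost surely positive,
  so the value 0, whose probability \<open>geometric_rv\<close> does not prescribe, is
  harmless.\<close>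

lemma geometric_rv_tail:
  assumes "prob_space M" "geometric_rv M p X" "0 < p" "p \<le> 1"
  shows "emeasure M {\<omega> \<in> space M. t < X \<omega>} = ennreal ((1 - p) ^ t)"
proof -
  interpret prob_space M by fact
  have X [measurable]: "X \<in> measurable M (count_space UNIV)"
    and eq: "\<And>m. m \<ge> 1 \<Longrightarrow> measure M {\<omega> \<in> space M. X \<omega> = m} = p * (1 - p) ^ (m - 1)"
    using assms(2) by (auto simp: geometric_rv_def)
  define A where "A i = {\<omega> \<in> space M. X \<omega> = Suc (t + i)}" for i
  have A: "range A \<subseteq> sets M" unfolding A_def by auto
  have "(\<lambda>i. measure M (A i)) sums measure M (\<Union>i. A i)"
    by (rule finite_measure_UNION[OF A]) (auto simp: disjoint_family_on_def A_def)
  moreover have "(\<Union>i. A i) = {\<omega> \<in> space M. t < X \<omega>}"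
    by (auto simp: A_def) (metis less_iff_Suc_add)
  moreover have "(\<lambda>i. p * (1 - p) ^ t * (1 - p) ^ i) sums (p * (1 - p) ^ t * (1 / (1 - (1 - p))))"
    by (intro sums_mult geometric_sums) (use assms in auto)
  moreover have "(\<lambda>i. measure M (A i)) = (\<lambda>i. p * (1 - p) ^ t * (1 - p) ^ i)"
    by (simp add: A_def eq power_add mult.assoc)
  ultimately have "measure M {\<omega> \<in> space M. t < X \<omega>} = (1 - p) ^ t"
    using assms(3) sums_unique2 by fastforce
  then show ?thesis by (simp add: emeasure_eq_measure)
qed

text \<open>The mean of a natural-valued variable is the sum of its tails, here again a geometric
  series.\<close>

lemma geometric_rv_integral:
  assumes "prob_space M" "geometric_rv M p X" "0 < p" "p \<le> 1"
  shows "has_bochner_integral M (\<lambda>\<omega>. real (X \<omega>)) (1 / p)"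
proof -
  have X [measurable]: "X \<in> measurable M (count_space UNIV)"
    using assms(2) by (auto simp: geometric_rv_def)
  have "(\<integral>\<^sup>+\<omega>. ennreal (real (X \<omega>)) \<partial>M) = (\<Sum>t. emeasure M {\<omega> \<in> space M. t < X \<omega>})"
    by (simp add: ennreal_of_nat_eq_real_of_nat[symmetric] nn_integral_nat_function)
  also have "\<dots> = (\<Sum>t. ennreal ((1 - p) ^ t))"
    using assms by (simp add: geometric_rv_tail)
  also have "\<dots> = ennreal (1 / p)"
    using geometric_sums[of "1 - p"] assms by (intro suminf_ennreal_eq) auto
  finally show ?thesis
    using assms by (intro has_bochner_integral_nn_integral) auto
qed

lemma expectation_of_sum_geometrics:
  assumes "\<theta> > 0" "indep_geometrics \<theta> n M X"
  shows "expectation_of_sum n M X = (\<Sum>i\<in>{2..n}. rate \<theta> n / rate \<theta> i)"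
proof -
  have "has_bochner_integral M (\<lambda>\<omega>. real (X i \<omega>)) (rate \<theta> n / rate \<theta> i)" if i: "i \<in> {2..n}" for i
  proof -
    have "rate \<theta> i > 0" "rate \<theta> n > 0" using assms i by (auto intro: rate_pos)
    then have "has_bochner_integral M (\<lambda>\<omega>. real (X i \<omega>)) (1 / (rate \<theta> i / rate \<theta> n))"
      using assms i rate_mono[of \<theta> i n]
      by (intro geometric_rv_integral) (auto simp: indep_geometrics_def rate_def)
    then show ?thesis by simp
  qed
  then have "has_bochner_integral M (\<lambda>\<omega>. \<Sum>i\<in>{2..n}. real (X i \<omega>)) (\<Sum>i\<in>{2..n}. rate \<theta> n / rate \<theta> i)"
    by (intro has_bochner_integral_sum)
  then show ?thesis by (simp add: expectation_of_sum_def has_bochner_integral_integral_eq)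
qed

section \<open>Logarithmic bounds and the asymptotics of the mean\<close>

lemma ln_ratio_has_derivative:
  fixes \<theta> x :: real
  assumes "\<theta> > 0" "\<theta> \<noteq> 1" "x \<ge> 1"
  shows "((\<lambda>x. ln (x / (\<theta> + x - 1)) / (\<theta> - 1)) has_real_derivative 1 / (x * (\<theta> + x - 1))) (at x)"
proof -
  have "x > 0" "\<theta> + x - 1 > 0" "\<theta> - 1 \<noteq> 0" using assms by auto
  \<comment> \<open>Partial fractions: \<open>1 / (x * (\<theta> + x - 1))\<close> is
    \<open>(1 / x - 1 / (\<theta> + x - 1)) / (\<theta> - 1)\<close>.\<close>
  then show ?thesis
    by (auto intro!: derivative_eq_intros simp: divide_simps)
qed

text \<open>By the mean value theorem the increment is the derivative at a point between
  \<open>x\<close> and \<open>x + 1\<close>, and the derivative decreases on this range.\<close>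

lemma ln_ratio_increment:
  fixes \<theta> x :: real
  assumes "\<theta> > 0" "\<theta> \<noteq> 1" "x \<ge> 1"
  defines "F \<equiv> \<lambda>x. ln (x / (\<theta> + x - 1)) / (\<theta> - 1)"
  shows "1 / ((x + 1) * (\<theta> + (x + 1) - 1)) \<le> F (x + 1) - F x" "F (x + 1) - F x \<le> 1 / (x * (\<theta> + x - 1))"
proof -
  obtain z where z: "x < z" "z < x + 1" "F (x + 1) - F x = (x + 1 - x) * (1 / (z * (\<theta> + z - 1)))"
    using MVT2[of x "x + 1" F "\<lambda>z. 1 / (z * (\<theta> + z - 1))"] ln_ratio_has_derivative[OF assms(1,2)] assms(3)
    unfolding F_def by auto
  have pos: "x * (\<theta> + x - 1) > 0" "z * (\<theta> + z - 1) > 0" using z assms by auto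
  have mono: "x * (\<theta> + x - 1) \<le> z * (\<theta> + z - 1)"
      "z * (\<theta> + z - 1) \<le> (x + 1) * (\<theta> + (x + 1) - 1)"
    using z assms by (auto intro!: mult_mono)
  have inc: "F (x + 1) - F x = 1 / (z * (\<theta> + z - 1))" using z(3) by simp
  show "1 / ((x + 1) * (\<theta> + (x + 1) - 1)) \<le> F (x + 1) - F x"
    unfolding inc using mono(2) pos(2) by (rule frac_le[OF zero_le_one order_refl, rotated])
  show "F (x + 1) - F x \<le> 1 / (x * (\<theta> + x - 1))"
    unfolding inc using mono(1) pos(1) by (rule frac_le[OF zero_le_one order_refl, rotated])
qed

text \<open>Integral comparison: the sum lies between \<open>F (n + 1) - F 2\<close> and
  \<open>F n - F 1\<close>. Keeping \<open>1 / (\<theta> - 1)\<close> inside \<open>F\<close> makes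
  both signs of \<open>\<theta> - 1\<close> one case.\<close>

lemma sum_inverse_rate_bounds:
  assumes "\<theta> > 0" "\<theta> \<noteq> 1" "n \<ge> 1"
  shows "ln ((real n + 1) * (\<theta> + 1) / (2 * (real n + \<theta>))) / (\<theta> - 1) \<le> (\<Sum>i\<in>{2..n}. 1 / rate \<theta> i)"
    "(\<Sum>i\<in>{2..n}. 1 / rate \<theta> i) \<le> ln (real n * \<theta> / (real n + \<theta> - 1)) / (\<theta> - 1)"
proof -
  define F where "F = (\<lambda>x. ln (x / (\<theta> + x - 1)) / (\<theta> - 1))"
  have inc: "1 / ((x + 1) * (\<theta> + (x + 1) - 1)) \<le> F (x + 1) - F x"
      "F (x + 1) - F x \<le> 1 / (x * (\<theta> + x - 1))" if "x \<ge> 1" for x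
    using ln_ratio_increment[OF assms(1,2) that] unfolding F_def by blast+
  have bounds: "F (real n + 1) - F 2 \<le> (\<Sum>i\<in>{2..n}. 1 / rate \<theta> i) \<and>
      (\<Sum>i\<in>{2..n}. 1 / rate \<theta> i) \<le> F (real n) - F 1"
    using assms(3)
  proof (induction n rule: nat_induct_at_least)
    case base
    then show ?case by simp
  next
    case (Suc m)
    then have "{2..Suc m} = insert (Suc m) {2..m}" by auto
    then have "(\<Sum>i\<in>{2..Suc m}. 1 / rate \<theta> i) = 1 / rate \<theta> (Suc m) + (\<Sum>i\<in>{2..m}. 1 / rate \<theta> i)" by simp
    moreover have "1 / rate \<theta> (Suc m) \<le> F (real (Suc m)) - F (real m)"
      using inc(1)[of "real m"] Suc.hyps by (simp add: rate_def add_ac)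
    moreover have "F (real (Suc m) + 1) - F (real (Suc m)) \<le> 1 / rate \<theta> (Suc m)"
      using inc(2)[of "real (Suc m)"] by (simp add: rate_def)
    ultimately show ?case using Suc.IH by (simp add: add.commute)
  qed
  have n: "real n \<ge> 1" using assms by simp
  have "F (real n + 1) - F 2 = (ln ((real n + 1) / (\<theta> + real n)) - ln (2 / (\<theta> + 1))) / (\<theta> - 1)"
    by (simp add: F_def diff_divide_distrib add.commute)
  also have "ln ((real n + 1) / (\<theta> + real n)) - ln (2 / (\<theta> + 1))
      = ln (((real n + 1) / (\<theta> + real n)) / (2 / (\<theta> + 1)))"
    using n assms by (subst ln_div) auto
  also have "((real n + 1) / (\<theta> + real n)) / (2 / (\<theta> + 1)) = (real n + 1) * (\<theta> + 1) / (2 * (real n + \<theta>))"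
    by (simp add: add.commute)
  finally show "ln ((real n + 1) * (\<theta> + 1) / (2 * (real n + \<theta>))) / (\<theta> - 1) \<le> (\<Sum>i\<in>{2..n}. 1 / rate \<theta> i)"
    using bounds by simp
  have "F (real n) - F 1 = (ln (real n / (\<theta> + real n - 1)) - ln (1 / \<theta>)) / (\<theta> - 1)"
    by (simp add: F_def diff_divide_distrib add.commute)
  also have "ln (real n / (\<theta> + real n - 1)) - ln (1 / \<theta>) = ln ((real n / (\<theta> + real n - 1)) / (1 / \<theta>))"
    using n assms by (subst ln_div) auto
  also have "(real n / (\<theta> + real n - 1)) / (1 / \<theta>) = real n * \<theta> / (real n + \<theta> - 1)"
    by (simp add: add.commute)
  finally show "(\<Sum>i\<in>{2..n}. 1 / rate \<theta> i) \<le> ln (real n * \<theta> / (real n + \<theta> - 1)) / (\<theta> - 1)"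
    using bounds by simp
qed

lemma sum_inverse_squares_from_2_tendsto:
  "(\<lambda>n. \<Sum>i\<in>{2..n}. 1 / real i ^ 2) \<longlonglongrightarrow> pi\<^sup>2 / 6 - 1"
proof -
  have eq: "(\<Sum>i<n. 1 / (real i + 1)\<^sup>2) = 1 + (\<Sum>i\<in>{2..n}. 1 / real i ^ 2)" if "n \<ge> 1" for n
    using that
  proof (induction n rule: nat_induct_at_least)
    case (Suc m)
    then have "{2..Suc m} = insert (Suc m) {2..m}" by auto
    then show ?case using Suc by (simp add: add.commute)
  qed simp
  have "(\<lambda>n. (\<Sum>i<n. 1 / (real i + 1)\<^sup>2) - 1) \<longlonglongrightarrow> pi\<^sup>2 / 6 - 1"
    using inverse_squares_sums by (intro tendsto_diff) (auto simp: sums_def add.commute)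
  \<comment> \<open>Only eventually: at \<open>n = 0\<close> the full series has no first term to
    take away.\<close>
  moreover have "\<forall>\<^sub>F n in sequentially. (\<Sum>i<n. 1 / (real i + 1)\<^sup>2) - 1 = (\<Sum>i\<in>{2..n}. 1 / real i ^ 2)"
    using eventually_ge_at_top[of 1] by eventually_elim (simp add: eq)
  ultimately show ?thesis by (rule Lim_transform_eventually)
qed

text \<open>The limit constant must be nonzero for the quotient in the asymptotic
  equivalence.\<close>

lemma pi_squared_gt_6: "pi\<^sup>2 / 6 - 1 > 0"
proof -
  have "3 ^ 2 < pi ^ 2" using pi_gt3 by (intro power_strict_mono) auto
  then show ?thesis by simp
qed

theorem corollary7p6:
  fixes \<theta> \<alpha> :: real
    and M :: "nat \<Rightarrow> 'a measure"
    and X :: "nat \<Rightarrow> nat \<Rightarrow> 'a \<Rightarrow> nat"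
  assumes "\<theta> > 0" and "0 \<le> \<alpha>" and "\<alpha> < 1"
  shows "(\<forall>n\<ge>1. indep_geometrics \<theta> n (M n) (X n) \<longrightarrow>
            (expectation_of_sum n (M n) (X n) / 2 \<le> real (sep_mixing_time \<theta> \<alpha> n) \<and>
             real (sep_mixing_time \<theta> \<alpha> n) \<le> 2 * expectation_of_sum n (M n) (X n)) \<and>
            (\<theta> = 1 \<longrightarrow>
               expectation_of_sum n (M n) (X n) = (\<Sum>i\<in>{2..n}. real n ^ 2 / real i ^ 2)) \<and>
            (\<theta> \<noteq> 1 \<longrightarrow>
               real n * (\<theta> + real n - 1) / (\<theta> - 1)
                 * ln ((real n + 1) * (\<theta> + 1) / (2 * (real n + \<theta>)))
                 \<le> expectation_of_sum n (M n) (X n) \<and>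
               expectation_of_sum n (M n) (X n)
                 = (\<Sum>i\<in>{2..n}. real n * (\<theta> + real n - 1) / (real i * (\<theta> + real i - 1))) \<and>
               expectation_of_sum n (M n) (X n)
                 \<le> real n * (\<theta> + real n - 1) / (\<theta> - 1)
                   * ln (real n * \<theta> / (real n + \<theta> - 1))))
         \<and> (\<theta> = 1 \<and> (\<forall>n\<ge>1. indep_geometrics \<theta> n (M n) (X n)) \<longrightarrow>
              (\<lambda>n. expectation_of_sum n (M n) (X n))
                \<sim>[at_top] (\<lambda>n. real n ^ 2 * (pi ^ 2 / 6 - 1)))"
proof -
  have main: "(expectation_of_sum n (M n) (X n) / 2 \<le> real (sep_mixing_time \<theta> \<alpha> n) \<and>
             real (sep_mixing_time \<theta> \<alpha> n) \<le> 2 * expectation_of_sum n (M n) (X n)) \<and>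
            (\<theta> = 1 \<longrightarrow>
               expectation_of_sum n (M n) (X n) = (\<Sum>i\<in>{2..n}. real n ^ 2 / real i ^ 2)) \<and>
            (\<theta> \<noteq> 1 \<longrightarrow>
               real n * (\<theta> + real n - 1) / (\<theta> - 1)
                 * ln ((real n + 1) * (\<theta> + 1) / (2 * (real n + \<theta>)))
                 \<le> expectation_of_sum n (M n) (X n) \<and>
               expectation_of_sum n (M n) (X n)
                 = (\<Sum>i\<in>{2..n}. real n * (\<theta> + real n - 1) / (real i * (\<theta> + real i - 1))) \<and>
               expectation_of_sum n (M n) (X n)
                 \<le> real n * (\<theta> + real n - 1) / (\<theta> - 1)
                   * ln (real n * \<theta> / (real n + \<theta> - 1)))"
    (is "?mix \<and> (\<theta> = 1 \<longrightarrow> ?eq) \<and> (\<theta> \<noteq> 1 \<longrightarrow> ?lower \<and> ?sum \<and> ?upper)")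
    if n: "n \<ge> 1" and ind: "indep_geometrics \<theta> n (M n) (X n)" for n
  proof (intro conjI impI)
    let ?E = "expectation_of_sum n (M n) (X n)"
    have E: "?E = (\<Sum>i\<in>{2..n}. rate \<theta> n / rate \<theta> i)"
      using expectation_of_sum_geometrics[OF assms(1) ind] .
    then have E': "?E = rate \<theta> n * (\<Sum>i\<in>{2..n}. 1 / rate \<theta> i)"
      by (simp add: sum_distrib_left)
    have pos: "rate \<theta> n \<ge> 0" using assms(1) n rate_pos less_imp_le by blast
    show "?E / 2 \<le> real (sep_mixing_time \<theta> \<alpha> n)" "real (sep_mixing_time \<theta> \<alpha> n) \<le> 2 * ?E"
      unfolding E by (rule sep_mixing_time_bounds[OF assms n])+
    show ?eq if "\<theta> = 1" using E that by (simp add: rate_def power2_eq_square)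
    show ?sum using E by (simp add: rate_def)
    show ?lower ?upper if "\<theta> \<noteq> 1"
      using sum_inverse_rate_bounds[OF assms(1) that n, THEN mult_left_mono, OF pos]
      unfolding E'[symmetric] by (simp_all add: rate_def)
  qed
  have asymp: "(\<lambda>n. expectation_of_sum n (M n) (X n)) \<sim>[at_top] (\<lambda>n. real n ^ 2 * (pi\<^sup>2 / 6 - 1))"
    if "\<theta> = 1" and ind: "\<forall>n\<ge>1. indep_geometrics \<theta> n (M n) (X n)"
  proof (rule asymp_equivI')
    let ?c = "pi\<^sup>2 / 6 - 1 :: real"
    have "(\<lambda>n. (\<Sum>i\<in>{2..n}. 1 / real i ^ 2) / ?c) \<longlonglongrightarrow> ?c / ?c"
      by (intro tendsto_divide sum_inverse_squares_from_2_tendsto tendsto_const)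
         (use pi_squared_gt_6 in simp)
    then have "(\<lambda>n. (\<Sum>i\<in>{2..n}. 1 / real i ^ 2) / ?c) \<longlonglongrightarrow> 1"
      using pi_squared_gt_6 by simp
    moreover have "\<forall>\<^sub>F n in sequentially. (\<Sum>i\<in>{2..n}. 1 / real i ^ 2) / ?c
        = expectation_of_sum n (M n) (X n) / (real n ^ 2 * ?c)"
      using eventually_ge_at_top[of 1]
    proof eventually_elim
      case (elim n)
      then have "expectation_of_sum n (M n) (X n) = real n ^ 2 * (\<Sum>i\<in>{2..n}. 1 / real i ^ 2)"
        using main[OF elim] ind that(1) by (simp add: sum_distrib_left)
      then show ?case using elim by simp
    qed
    ultimately show "(\<lambda>n. expectation_of_sum n (M n) (X n) / (real n ^ 2 * ?c)) \<longlonglongrightarrow> 1"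
      by (rule Lim_transform_eventually)
  qed
  show ?thesis using main asymp by blast
qed

end
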